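(* Let $\langle P, G\rangle$ be a causal theory with finite directed acyclic graph $G$, and let $X, Y, Z, W$ be arbitrary pairwise disjoint sets of nodes (variables) of $G$. Let $x,y,z,w$ be arbitrary values of $X,Y,Z,W$. Then the following three rules hold, each equality being asserted whenever both conditional probabilities appearing in it are well defined (i.e. the events conditioned upon have positive probability under the respective post-intervention distributions). **Rule 1 (insertion/deletion of observations).** If $(Y \perp\!\!\!\perp Z \mid X, W)_{G_{\overline{X}}}$, then $$P(y\mid \hat{x}, z, w) = P(y\mid \hat{x}, w).$$ **Rule 2 (action/observation exchange).** If $(Y \perp\!\!\!\perp Z \mid X, W)_{G_{\overline{X}\,\underline{Z}}}$, then $$P(y\mid \hat{x}, \hat{z}, w) = P(y\mid \hat{x}, z, w).$$ **Rule 3 (insertion/deletion of actions).** If $(Y \perp\!\!\!\perp Z \mid X, W)_{G_{\overline{X}\,\overline{Z(W)}}}$, where $Z(W)$ is the set of nodes in $Z$ that are not ancestors of any node of $W$ in $G_{\overline{X}}$, then $$P(y\mid \hat{x}, \hat{z}, w) = P(y\mid \hat{x}, w).$$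
   Context: **Causal theory.** Let $G$ be a finite directed acyclic graph whose nodes are discrete random variables $X_1,\dots,X_n$; write $\mathbf{pa}_i$ for the set of parents of $X_i$ in $G$ (and also for a value of these parents). For each $i$ there is a deterministic function $f_i$ and a random disturbance $\epsilon_i$, with $\epsilon_1,\dots,\epsilon_n$ mutually independent and arbitrarily distributed, such that $$X_i = f_i(\mathbf{pa}_i,\epsilon_i),\qquad i=1,\dots,n.$$ A causal theory is a pair $\langle P,G\rangle$, where $P$ is the joint distribution of $(X_1,\dots,X_n)$ resulting from these functions. Writing $P(x_i\mid \mathbf{pa}_i)$ for the probability that $f_i(\mathbf{pa}_i,\epsilon_i)=x_i$, one has $P(x_1,\dots,x_n)=\prod_i P(x_i\mid \mathbf{pa}_i)$. Some of the nodes may represent unobserved variables; they are nodes of $G$ like any others. **Interventions.** For a set $S$ of nodes and a value $s$ of $S$, the intervention $do(S=s)$ replaces, for each $X_i\in S$, the mechanism $X_i=f_i(\mathbf{pa}_i,\epsilon_i)$ by $X_i=s_i$ (where $s_i$ is the coordinate of $s$ for $X_i$), leaving all other mechanisms unchanged. The resulting post-intervention distribution $P_s$ on $(X_1,\dots,X_n)$ is $$P_s(x_1,\dots,x_n)=\begin{cases}\prod_{i:\,X_i\notin S}P(x_i\mid \mathbf{pa}_i) & \text{if } x_i=s_i \text{ for all } X_i\in S,\\ 0 & \text{otherwise.}\end{cases}$$ For $S=\emptyset$ this is $P$. **Hat notation.** For disjoint sets of nodes, a hat marks variables that are held constant by external intervention, and unhatted conditioning variables are observed (ordinary conditioning in the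 post-intervention distribution). Thus $P(y\mid\hat x,z)$ means $P(y\mid do(X=x),\,Z=z)=P_x(Y=y, Z=z)/P_x(Z=z)$. Likewise $P(y\mid \hat x,z,w)=P_x(Y=y\mid Z=z,W=w)$, $P(y\mid\hat x,w)=P_x(Y=y\mid W=w)$, and $P(y\mid\hat x,\hat z,w)=P_{x,z}(Y=y\mid W=w)$, where $P_{x,z}$ is the distribution under the joint intervention $do(X=x, Z=z)$. **Graph notation.** For sets of nodes $A$ and $B$: $G_{\overline{A}}$ is the graph obtained from $G$ by deleting all arrows pointing to nodes in $A$; $G_{\underline{A}}$ is the graph obtained from $G$ by deleting all arrows emerging from nodes in $A$. $G_{\overline{A}\,\underline{B}}$ is obtained by deleting all arrows pointing to nodes in $A$ and all arrows emerging from nodes in $B$; $G_{\overline{A}\,\overline{B}}$ is obtained by deleting all arrows pointing to nodes in $A$ or in $B$. **d-separation.** For a directed acyclic graph $H$ and pairwise disjoint node sets $A,B,C$, $(A\perp\!\!\!\perp B\mid C)_H$ means that $C$ d-separates $A$ from $B$ in $H$: every path (ignoring arrow directions) in $H$ between a node of $A$ and a node of $B$ contains either a non-collider node belonging to $C$, or a collider node (both path arrows pointing into it) such that neither it nor any of its descendants in $H$ belongs to $C$. Here $(Y\perp\!\!\!\perp Z\mid X,W)_H$ means $(Y\perp\!\!\!\perp Z\mid X\cup W)_H$. A node counts as an ancestor of a node $v$ in $H$ if there is a directed path from it to $v$ in $H$. *)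

theory Defs
  imports "HOL-Probability.Probability"
begin

section \<open>Causal theories\<close>

text \<open>
  The disturbances \<open>noise T i\<close> are random variables on one probability space \<open>base T\<close>.
  A value of a set \<open>S\<close> of nodes is an element of \<open>Pi\<^sub>E S (vals T)\<close>; \<open>mech T i p e\<close> is the
  value that the mechanism of node \<open>i\<close> produces from the value \<open>p\<close> of its parents and
  the disturbance \<open>e\<close>.
\<close>

record ('n, 'v, 'w, 'e) structural_model =
  nodes :: "'n set"
  arrows :: "('n \<times> 'n) set"
  vals :: "'n \<Rightarrow> 'v set"
  base :: "'w measure"
  noise_space :: "'n \<Rightarrow> 'e measure"
  noise :: "'n \<Rightarrow> 'w \<Rightarrow> 'e"
  mech :: "'n \<Rightarrow> ('n \<Rightarrow> 'v) \<Rightarrow> 'e \<Rightarrow> 'v"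

definition parents :: "('n, 'v, 'w, 'e, 'z) structural_model_scheme \<Rightarrow> 'n \<Rightarrow> 'n set" where
  "parents T i = {j. (j, i) \<in> arrows T}"

locale causal_theory =
  fixes T :: "('n, 'v, 'w, 'e) structural_model"
  assumes finite_nodes: "finite (nodes T)"
    and arrows_nodes: "arrows T \<subseteq> nodes T \<times> nodes T"
    and acyclic_arrows: "acyclic (arrows T)"
    and countable_vals: "i \<in> nodes T \<Longrightarrow> countable (vals T i)"
    and prob_space_base: "prob_space (base T)"
    and indep_noise: "prob_space.indep_vars (base T) (noise_space T) (noise T) (nodes T)"
    and measurable_mech: "i \<in> nodes T \<Longrightarrow> p \<in> Pi\<^sub>E (parents T i) (vals T) \<Longrightarrow>
           mech T i p \<in> measurable (noise_space T i) (count_space (vals T i))"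

definition is_solution ::
    "('n, 'v, 'w, 'e) structural_model \<Rightarrow> 'w \<Rightarrow> ('n \<Rightarrow> 'v) \<Rightarrow> bool" where
  "is_solution T \<omega> v \<longleftrightarrow> v \<in> extensional (nodes T) \<and>
     (\<forall>i\<in>nodes T. v i = mech T i (restrict v (parents T i)) (noise T i \<omega>))"

definition solution :: "('n, 'v, 'w, 'e) structural_model \<Rightarrow> 'w \<Rightarrow> 'n \<Rightarrow> 'v" where
  "solution T \<omega> = (THE v. is_solution T \<omega> v)"

definition joint :: "('n, 'v, 'w, 'e) structural_model \<Rightarrow> ('n \<Rightarrow> 'v) measure" where
  "joint T = distr (base T) (count_space (Pi\<^sub>E (nodes T) (vals T))) (solution T)"

text \<open>The post-intervention distribution \<open>P\<^sub>s\<close> is \<open>joint (intervene T S s)\<close>. The graph is kept: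
  the new mechanisms of the nodes in \<open>S\<close> just ignore their parents.\<close>

definition intervene ::
    "('n, 'v, 'w, 'e) structural_model \<Rightarrow> 'n set \<Rightarrow> ('n \<Rightarrow> 'v) \<Rightarrow> ('n, 'v, 'w, 'e) structural_model" where
  "intervene T S s = T\<lparr>mech := (\<lambda>i. if i \<in> S then (\<lambda>p e. s i) else mech T i)\<rparr>"


section \<open>Graph surgery and d-separation\<close>

definition cut_into :: "'n set \<Rightarrow> ('n \<times> 'n) set \<Rightarrow> ('n \<times> 'n) set" where
  "cut_into A H = {(u, v) \<in> H. v \<notin> A}"

definition cut_out_of :: "'n set \<Rightarrow> ('n \<times> 'n) set \<Rightarrow> ('n \<times> 'n) set" where
  "cut_out_of A H = {(u, v) \<in> H. u \<notin> A}"

definition undirected_path :: "('n \<times> 'n) set \<Rightarrow> 'n list \<Rightarrow> bool" where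
  "undirected_path H p \<longleftrightarrow> p \<noteq> [] \<and> distinct p \<and>
     successively (\<lambda>u v. (u, v) \<in> H \<or> (v, u) \<in> H) p"

definition collider :: "('n \<times> 'n) set \<Rightarrow> 'n list \<Rightarrow> nat \<Rightarrow> bool" where
  "collider H p k \<longleftrightarrow> 0 < k \<and> Suc k < length p \<and>
     (p ! (k - 1), p ! k) \<in> H \<and> (p ! Suc k, p ! k) \<in> H"

definition blocked :: "('n \<times> 'n) set \<Rightarrow> 'n set \<Rightarrow> 'n list \<Rightarrow> bool" where
  "blocked H C p \<longleftrightarrow> (\<exists>k<length p.
     if collider H p k then H\<^sup>* `` {p ! k} \<inter> C = {} else p ! k \<in> C)"

definition d_separated ::
    "('n \<times> 'n) set \<Rightarrow> 'n set \<Rightarrow> 'n set \<Rightarrow> 'n set \<Rightarrow> bool" where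
  "d_separated H A B C \<longleftrightarrow>
     (\<forall>p. undirected_path H p \<and> hd p \<in> A \<and> last p \<in> B \<longrightarrow> blocked H C p)"

definition non_ancestors :: "('n \<times> 'n) set \<Rightarrow> 'n set \<Rightarrow> 'n set \<Rightarrow> 'n set" where
  "non_ancestors H Z W = {u \<in> Z. \<forall>v\<in>W. (u, v) \<notin> H\<^sup>*}"


section \<open>Well-definedness and truncated factorization\<close>

context causal_theory
begin

lemma wf_arrows: "wf (arrows T)"
  using finite_nodes arrows_nodes acyclic_arrows
  by (intro finite_acyclic_wf) (auto intro: finite_subset)

lemma parents_subset: "parents T i \<subseteq> nodes T"
  using arrows_nodes by (auto simp: parents_def)

lemma is_solution_unique:
  assumes v: "is_solution T \<omega> v" and w: "is_solution T \<omega> w"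
  shows "v = w"
proof -
  have "i \<in> nodes T \<longrightarrow> v i = w i" for i
  proof (induction i rule: wf_induct_rule[OF wf_arrows])
    case (1 i)
    then have "restrict v (parents T i) = restrict w (parents T i)"
      using parents_subset by (intro restrict_ext) (auto simp: parents_def)
    then show ?case using v w unfolding is_solution_def by metis
  qed
  then show ?thesis using v w unfolding is_solution_def by (metis extensionalityI)
qed

lemma is_solution_exists: "\<exists>v. is_solution T \<omega> v"
proof -
  define g where "g = wfrec (arrows T) (\<lambda>h i. if i \<in> nodes T
     then mech T i (restrict h (parents T i)) (noise T i \<omega>) else undefined)"
  have r: "restrict (cut g (arrows T) i) (parents T i) = restrict g (parents T i)" for i
    by (intro restrict_ext) (auto simp: parents_def cut_apply)
  have g: "g i = (if i \<in> nodes T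
      then mech T i (restrict g (parents T i)) (noise T i \<omega>) else undefined)" for i
    unfolding g_def by (subst wfrec[OF wf_arrows]) (simp add: r[unfolded g_def])
  have "g i = mech T i (restrict g (parents T i)) (noise T i \<omega>)" if "i \<in> nodes T" for i
    by (subst g) (simp only: that if_True)
  moreover have "g i = undefined" if "i \<notin> nodes T" for i
    by (subst g) (simp only: that if_False)
  ultimately have "is_solution T \<omega> g"
    unfolding is_solution_def extensional_def by blast
  then show ?thesis by blast
qed

lemma is_solution_solution: "is_solution T \<omega> (solution T \<omega>)"
proof -
  obtain v where v: "is_solution T \<omega> v" using is_solution_exists by blast
  show ?thesis unfolding solution_def
    by (rule theI[where P = "is_solution T \<omega>", OF v]) (rule is_solution_unique[OF _ v])
qed

lemma solution_eq_iff: "solution T \<omega> = v \<longleftrightarrow> is_solution T \<omega> v"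
proof
  show "is_solution T \<omega> v" if "solution T \<omega> = v"
    using is_solution_solution[of \<omega>] that by simp
  show "solution T \<omega> = v" if "is_solution T \<omega> v"
    by (rule is_solution_unique[OF is_solution_solution that])
qed

lemma measurable_noise: "i \<in> nodes T \<Longrightarrow> noise T i \<in> measurable (base T) (noise_space T i)"
  using indep_noise unfolding prob_space.indep_vars_def[OF prob_space_base] by blast

lemma solution_in_PiE:
  assumes "\<omega> \<in> space (base T)"
  shows "solution T \<omega> \<in> Pi\<^sub>E (nodes T) (vals T)"
proof -
  let ?v = "solution T \<omega>"
  have sol: "is_solution T \<omega> ?v" by (rule is_solution_solution)
  have "i \<in> nodes T \<longrightarrow> ?v i \<in> vals T i" for i
  proof (induction i rule: wf_induct_rule[OF wf_arrows])
    case (1 i)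
    show ?case
    proof
      assume i: "i \<in> nodes T"
      have "restrict ?v (parents T i) \<in> Pi\<^sub>E (parents T i) (vals T)"
        using 1 parents_subset by (auto simp: parents_def subset_iff)
      from measurable_space[OF measurable_mech[OF i this] measurable_space[OF measurable_noise[OF i] assms]]
      show "?v i \<in> vals T i" using sol i by (simp add: is_solution_def)
    qed
  qed
  then show ?thesis using sol by (auto simp: is_solution_def PiE_iff)
qed

lemma measurable_mech_noise:
  assumes "i \<in> nodes T" "p \<in> Pi\<^sub>E (parents T i) (vals T)"
  shows "(\<lambda>\<omega>. mech T i p (noise T i \<omega>)) \<in> measurable (base T) (count_space (vals T i))"
  using measurable_compose[OF measurable_noise measurable_mech] assms by blast

lemma restrict_parents:
  "v \<in> Pi\<^sub>E (nodes T) (vals T) \<Longrightarrow> restrict v (parents T i) \<in> Pi\<^sub>E (parents T i) (vals T)"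
  using parents_subset by (auto simp: PiE_iff subset_iff)

lemma solution_vimage:
  assumes "v \<in> Pi\<^sub>E (nodes T) (vals T)"
  shows "solution T -` {v} \<inter> space (base T) = {\<omega> \<in> space (base T). \<forall>i\<in>nodes T.
           mech T i (restrict v (parents T i)) (noise T i \<omega>) = v i}"
proof -
  have "solution T \<omega> = v \<longleftrightarrow>
      (\<forall>i\<in>nodes T. mech T i (restrict v (parents T i)) (noise T i \<omega>) = v i)" for \<omega>
    using assms unfolding solution_eq_iff is_solution_def PiE_iff by metis
  then show ?thesis by blast
qed

lemma countable_PiE_vals: "countable (Pi\<^sub>E (nodes T) (vals T))"
  using finite_nodes countable_vals by (intro countable_PiE) auto

lemma measurable_solution:
  "solution T \<in> measurable (base T) (count_space (Pi\<^sub>E (nodes T) (vals T)))"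
proof (subst measurable_count_space_eq_countable[OF countable_PiE_vals], intro conjI ballI)
  show "solution T \<in> space (base T) \<rightarrow> Pi\<^sub>E (nodes T) (vals T)"
    using solution_in_PiE by auto
  fix v assume v: "v \<in> Pi\<^sub>E (nodes T) (vals T)"
  have "{\<omega> \<in> space (base T). mech T i (restrict v (parents T i)) (noise T i \<omega>) = v i}
      \<in> sets (base T)" if i: "i \<in> nodes T" for i
  proof -
    have "(\<lambda>\<omega>. mech T i (restrict v (parents T i)) (noise T i \<omega>)) -` {v i} \<inter> space (base T)
        \<in> sets (base T)"
      using v i by (intro measurable_sets[OF measurable_mech_noise[OF i restrict_parents[OF v]]]) auto
    then show ?thesis by (auto simp: vimage_def Int_def conj_commute)
  qed
  then show "solution T -` {v} \<inter> space (base T) \<in> sets (base T)"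
    unfolding solution_vimage[OF v] using finite_nodes by (intro sets.sets_Collect_finite_All) auto
qed

lemma prob_space_joint: "prob_space (joint T)"
  unfolding joint_def by (rule prob_space.prob_space_distr[OF prob_space_base measurable_solution])

lemma causal_theory_intervene:
  assumes "s \<in> Pi\<^sub>E S (vals T)"
  shows "causal_theory (intervene T S s)"
proof (rule causal_theory.intro)
  fix i p
  assume i: "i \<in> nodes (intervene T S s)"
    and p: "p \<in> Pi\<^sub>E (parents (intervene T S s) i) (vals (intervene T S s))"
  have "i \<in> nodes T" "p \<in> Pi\<^sub>E (parents T i) (vals T)"
    using i p by (simp_all add: parents_def intervene_def)
  then have "mech T i p \<in> measurable (noise_space T i) (count_space (vals T i))"
    by (rule measurable_mech)
  moreover have "s i \<in> vals T i" if "i \<in> S" using assms that by (rule PiE_mem)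
  ultimately show "mech (intervene T S s) i p \<in> measurable (noise_space (intervene T S s) i)
      (count_space (vals (intervene T S s) i))"
    by (simp add: intervene_def)
qed (simp_all add: intervene_def finite_nodes arrows_nodes acyclic_arrows countable_vals
       prob_space_base indep_noise)

lemma factorization:
  assumes v: "v \<in> Pi\<^sub>E (nodes T) (vals T)"
  shows "measure (joint T) {v} = (\<Prod>i\<in>nodes T.
           \<P>(\<omega> in base T. mech T i (restrict v (parents T i)) (noise T i \<omega>) = v i))"
proof -
  interpret prob_space "base T" by (rule prob_space_base)
  let ?f = "\<lambda>i e. mech T i (restrict v (parents T i)) e"
  have "measure (joint T) {v} = measure (base T) (solution T -` {v} \<inter> space (base T))"
    unfolding joint_def using v by (intro measure_distr[OF measurable_solution]) auto
  also have "\<dots> = (\<Prod>i\<in>nodes T. \<P>(\<omega> in base T. ?f i (noise T i \<omega>) = v i))"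
  proof (cases "nodes T = {}")
    case True
    then show ?thesis unfolding solution_vimage[OF v] by (simp add: prob_space)
  next
    case False
    have "indep_vars (\<lambda>i. count_space (vals T i)) (\<lambda>i. ?f i \<circ> noise T i) (nodes T)"
      using indep_noise by (rule indep_vars_compose) (use measurable_mech restrict_parents[OF v] in auto)
    then have "prob (\<Inter>i\<in>nodes T. (?f i \<circ> noise T i) -` {v i} \<inter> space (base T))
      = (\<Prod>i\<in>nodes T. prob ((?f i \<circ> noise T i) -` {v i} \<inter> space (base T)))"
      using v by (intro indep_varsD[OF _ False finite_nodes]) auto
    also have "(\<Inter>i\<in>nodes T. (?f i \<circ> noise T i) -` {v i} \<inter> space (base T))
        = solution T -` {v} \<inter> space (base T)"
      unfolding solution_vimage[OF v] using False by auto
    also have "(\<lambda>i. (?f i \<circ> noise T i) -` {v i} \<inter> space (base T))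
        = (\<lambda>i. {\<omega> \<in> space (base T). ?f i (noise T i \<omega>) = v i})"
      by auto
    finally show ?thesis .
  qed
  finally show ?thesis .
qed

lemma truncated_factorization:
  assumes S: "S \<subseteq> nodes T" and s: "s \<in> Pi\<^sub>E S (vals T)" and v: "v \<in> Pi\<^sub>E (nodes T) (vals T)"
  shows "measure (joint (intervene T S s)) {v} = (if \<forall>i\<in>S. v i = s i
    then \<Prod>i\<in>nodes T - S. \<P>(\<omega> in base T. mech T i (restrict v (parents T i)) (noise T i \<omega>) = v i)
    else 0)"
proof -
  interpret prob_space "base T" by (rule prob_space_base)
  interpret I: causal_theory "intervene T S s" by (rule causal_theory_intervene[OF s])
  let ?p = "\<lambda>i. \<P>(\<omega> in base T. mech T i (restrict v (parents T i)) (noise T i \<omega>) = v i)"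
  have "measure (joint (intervene T S s)) {v} =
      (\<Prod>i\<in>nodes T. if i \<in> S then (if v i = s i then 1 else 0) else ?p i)"
    using v by (subst I.factorization)
      (auto simp: intervene_def parents_def prob_space intro!: prod.cong)
  also have "\<dots> = (\<Prod>i\<in>nodes T - S. ?p i) * (\<Prod>i\<in>S. if v i = s i then 1 else 0)"
    by (subst prod.subset_diff[OF S finite_nodes]) (auto intro!: arg_cong2[where f="(*)"] prod.cong)
  also have "\<dots> = (if \<forall>i\<in>S. v i = s i then \<Prod>i\<in>nodes T - S. ?p i else 0)"
    using finite_subset[OF S finite_nodes] by auto
  finally show ?thesis .
qed

end

end

theory Submission
  imports Defs
begin

text \<open>
  Let \<open>C = X \<union> W\<close>, let \<open>H\<close> be the graph in the d-separation hypothesis and \<open>R\<close> the set of nodes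
  reachable from \<open>Y\<close> by paths that \<open>C\<close> does not block in \<open>H\<close>, so that \<open>R\<close> misses \<open>Z\<close> and \<open>C\<close>.
  If \<open>i\<close> is an ancestor in \<open>H\<close> of \<open>Y \<union> Z \<union> C\<close>, then the family of \<open>i\<close> (\<open>i\<close> and its parents),
  apart from nodes of \<open>C\<close>, lies either inside \<open>R\<close> or outside \<open>R\<close>. Hence, once the values on \<open>C\<close>
  (and on \<open>Z\<close>, for Rule 2) are fixed, the truncated factorization over an ancestral set \<open>A\<close>
  is a product of a function of the nodes in \<open>U = R \<inter> A\<close> and a function of those in \<open>A - U\<close>,
  and so are its sums. The two distributions compared in each rule share the factor that belongs
  to \<open>U\<close>, which is the only one affected by the event \<open>Y = y\<close>; the other one cancels in the
  conditional probability. For Rule 3, \<open>A\<close> consists of the ancestors of \<open>Y \<union> C\<close> only, and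
  d-separation forces \<open>A\<close> to miss \<open>Z(W)\<close>.
\<close>

section \<open>Nodes reachable by open paths\<close>

definition open_path :: "('n \<times> 'n) set \<Rightarrow> 'n set \<Rightarrow> 'n list \<Rightarrow> bool" where
  "open_path H C p \<longleftrightarrow> undirected_path H p \<and> (\<forall>k. Suc k < length p \<longrightarrow>
     (if collider H p k then H\<^sup>* `` {p ! k} \<inter> C \<noteq> {} else p ! k \<notin> C))"

text \<open>\<open>v \<notin> C\<close> supplies the condition at the endpoint that
  \<open>open_path\<close> leaves out.\<close>

definition active_reach :: "('n \<times> 'n) set \<Rightarrow> 'n set \<Rightarrow> 'n set \<Rightarrow> 'n set" where
  "active_reach H Y C = {v. v \<notin> C \<and> (\<exists>p. open_path H C p \<and> hd p \<in> Y \<and> last p = v)}"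

text \<open>Unlike \<open>\<not> blocked\<close>, \<open>open_path\<close> does not constrain the last node, so it is
  inherited by prefixes.\<close>

lemma open_path_not_blocked:
  assumes "open_path H C p" "last p \<notin> C"
  shows "\<not> blocked H C p"
proof
  assume "blocked H C p"
  then obtain k where k: "k < length p"
    "if collider H p k then H\<^sup>* `` {p ! k} \<inter> C = {} else p ! k \<in> C"
    unfolding blocked_def by blast
  show False
  proof (cases "Suc k < length p")
    case True
    then show False using k assms(1) unfolding open_path_def by metis
  next
    case False
    then have "k = length p - 1" "p \<noteq> []" using k by auto
    then have "p ! k = last p" by (simp add: last_conv_nth)
    with False k assms(2) show False by (auto simp: collider_def)
  qed
qed

lemma d_separated_active_reach:
  "d_separated H Y Z C \<Longrightarrow> Z \<inter> active_reach H Y C = {}"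
  using open_path_not_blocked unfolding d_separated_def active_reach_def open_path_def by blast

section \<open>Prefixes and one-step extensions of open paths\<close>

lemma open_path_singleton: "open_path H C [v]"
  by (simp add: open_path_def undirected_path_def)

lemma collider_take: "Suc k < n \<Longrightarrow> n \<le> length p \<Longrightarrow> collider H (take n p) k = collider H p k"
  by (auto simp: collider_def)

lemma collider_append: "Suc k < length p \<Longrightarrow> collider H (p @ q) k = collider H p k"
  by (auto simp: collider_def nth_append)

lemma open_path_take:
  assumes p: "open_path H C p" and n: "0 < n" "n \<le> length p"
  shows "open_path H C (take n p)"
proof -
  have "successively (\<lambda>u v. (u, v) \<in> H \<or> (v, u) \<in> H) (take n p @ drop n p)"
    using p unfolding open_path_def undirected_path_def by simp
  then have "successively (\<lambda>u v. (u, v) \<in> H \<or> (v, u) \<in> H) (take n p)"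
    unfolding successively_append_iff by blast
  then show ?thesis
    using p n unfolding open_path_def undirected_path_def by (auto simp: collider_take)
qed

text \<open>Appending a node can change the collider status of the old last node only; premise
  \<open>u\<close> is the openness condition there, which \<open>open_path\<close> had not yet
  imposed.\<close>

lemma open_path_snoc:
  assumes p: "open_path H C p" and v: "v \<notin> set p" "(last p, v) \<in> H \<or> (v, last p) \<in> H"
    and u: "if collider H (p @ [v]) (length p - 1) then H\<^sup>* `` {last p} \<inter> C \<noteq> {} else last p \<notin> C"
  shows "open_path H C (p @ [v])"
proof -
  have ne: "p \<noteq> []" using p by (auto simp: open_path_def undirected_path_def)
  have "undirected_path H (p @ [v])"
    using p v unfolding open_path_def undirected_path_def by (auto simp: successively_append_iff)
  moreover have "if collider H (p @ [v]) k then H\<^sup>* `` {(p @ [v]) ! k} \<inter> C \<noteq> {} else (p @ [v]) ! k \<notin> C"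
    if "Suc k < length (p @ [v])" for k
  proof (cases "Suc k < length p")
    case True
    then show ?thesis using p by (simp add: open_path_def collider_append nth_append)
  next
    case False
    then have k: "k = length p - 1" using that by simp
    then have "(p @ [v]) ! k = last p" using ne by (simp add: nth_append last_conv_nth)
    then show ?thesis using u k by simp
  qed
  ultimately show ?thesis unfolding open_path_def by blast
qed

text \<open>The witness is the prefix of \<open>p\<close> ending at \<open>v\<close>. If
  \<open>v \<in> C\<close> and \<open>last p \<notin> C\<close>, then \<open>v\<close> is not the
  last node, so openness makes it a collider and the prefix enters it by an arrow into
  \<open>v\<close>.\<close>

lemma active_reach_on_path:
  assumes p: "open_path H C p" "hd p \<in> Y" and v: "v \<in> set p"
  obtains q where "open_path H C q" "hd q \<in> Y" "last q = v" "set q \<subseteq> set p"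
    "v \<in> C \<Longrightarrow> last p \<notin> C \<Longrightarrow> length q > 1 \<and> (q ! (length q - 2), v) \<in> H"
proof -
  obtain k where k: "k < length p" "p ! k = v" using v by (auto simp: in_set_conv_nth)
  let ?q = "take (Suc k) p"
  have 1: "open_path H C ?q" using p k by (intro open_path_take) auto
  have 2: "hd ?q \<in> Y" using p k by simp
  have 3: "last ?q = v" using k by (simp add: take_Suc_conv_app_nth)
  have 4: "length ?q > 1 \<and> (?q ! (length ?q - 2), v) \<in> H" if "v \<in> C" "last p \<notin> C"
  proof -
    have "Suc k < length p"
    proof (rule ccontr)
      assume "\<not> Suc k < length p"
      then have "k = length p - 1" "p \<noteq> []" using k by auto
      then show False using that k by (simp add: last_conv_nth)
    qed
    then have "collider H p k" using p that k unfolding open_path_def by metis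
    then show ?thesis using k by (auto simp: collider_def min_def)
  qed
  show ?thesis using that[OF 1 2 3 _ 4] by (meson set_take_subset)
qed

text \<open>If the new node already lies on the path, a prefix of the path reaches it; this keeps
  the witnessing paths free of repetitions.\<close>

lemma active_reach_extend:
  assumes p: "open_path H C p" "hd p \<in> Y" and v: "v \<notin> C" "(last p, v) \<in> H \<or> (v, last p) \<in> H"
    and u: "if collider H (p @ [v]) (length p - 1) then H\<^sup>* `` {last p} \<inter> C \<noteq> {} else last p \<notin> C"
  shows "v \<in> active_reach H Y C"
proof (cases "v \<in> set p")
  case True
  obtain q where "open_path H C q" "hd q \<in> Y" "last q = v"
    by (rule active_reach_on_path[OF p True])
  then show ?thesis using v(1) unfolding active_reach_def by blast
next
  case False
  have "p \<noteq> []" using p by (auto simp: open_path_def undirected_path_def)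
  then show ?thesis
    using open_path_snoc[OF p(1) False v(2) u] p(2) v(1) unfolding active_reach_def
    by (auto intro!: exI[of _ "p @ [v]"])
qed

section \<open>Propagation of reachability along arrows\<close>

text \<open>Leaving \<open>u\<close> by an outgoing arrow makes it a non-collider, and
  \<open>u \<notin> C\<close> keeps the path open.\<close>

lemma active_reach_forward:
  assumes "acyclic H" "u \<in> active_reach H Y C" "(u, v) \<in> H" "v \<notin> C"
  shows "v \<in> active_reach H Y C"
proof -
  obtain p where p: "open_path H C p" "hd p \<in> Y" "last p = u" "u \<notin> C"
    using assms by (auto simp: active_reach_def)
  have ne: "p \<noteq> []" using p by (auto simp: open_path_def undirected_path_def)
  have "(v, u) \<notin> H" using assms by (meson acyclic_def r_into_trancl trancl_trans)
  then have "\<not> collider H (p @ [v]) (length p - 1)"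
    using ne p by (auto simp: collider_def nth_append last_conv_nth)
  then show ?thesis using active_reach_extend[OF p(1,2) assms(4)] assms p by auto
qed

text \<open>Here \<open>u\<close> may or may not become a collider: its descendant in
  \<open>C\<close> keeps it open in one case, \<open>u \<notin> C\<close> in the other.\<close>

lemma active_reach_backward:
  assumes "u \<in> active_reach H Y C" "(v, u) \<in> H" "v \<notin> C" "H\<^sup>* `` {u} \<inter> C \<noteq> {}"
  shows "v \<in> active_reach H Y C"
proof -
  obtain p where p: "open_path H C p" "hd p \<in> Y" "last p = u" "u \<notin> C"
    using assms by (auto simp: active_reach_def)
  then show ?thesis using active_reach_extend[OF p(1,2) assms(3)] assms by auto
qed

text \<open>A common child \<open>c\<close> in \<open>C\<close> is an open collider between its
  parents. If the path to \<open>u\<close> already visits \<open>c\<close>, its prefix up to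
  \<open>c\<close> also arrives by an arrow into \<open>c\<close>.\<close>

lemma active_reach_collider:
  assumes u: "u \<in> active_reach H Y C" and H: "(u, c) \<in> H" "(v, c) \<in> H" and C: "c \<in> C" "v \<notin> C"
    and acyc: "acyclic H"
  shows "v \<in> active_reach H Y C"
proof -
  obtain p where p: "open_path H C p" "hd p \<in> Y" "last p = u" "u \<notin> C"
    using u by (auto simp: active_reach_def)
  have ne: "p \<noteq> []" using p by (auto simp: open_path_def undirected_path_def)
  have "\<exists>q. open_path H C q \<and> hd q \<in> Y \<and> last q = c \<and> length q > 1 \<and> (q ! (length q - 2), c) \<in> H"
  proof (cases "c \<in> set p")
    case True
    then show ?thesis using active_reach_on_path[OF p(1,2) True] p C by metis
  next
    case False
    have "(c, u) \<notin> H" using H acyc by (meson acyclic_def r_into_trancl trancl_trans)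
    then have "\<not> collider H (p @ [c]) (length p - 1)"
      using ne p by (auto simp: collider_def nth_append last_conv_nth)
    then have "open_path H C (p @ [c])" using p H False by (intro open_path_snoc) auto
    then show ?thesis using ne p H
      by (intro exI[of _ "p @ [c]"]) (auto simp: nth_append last_conv_nth numeral_2_eq_2)
  qed
  then obtain q where q: "open_path H C q" "hd q \<in> Y" "last q = c" "length q > 1"
    "(q ! (length q - 2), c) \<in> H" by blast
  have "q ! (length q - 1) = c" using q last_conv_nth[of q] by force
  then have "collider H (q @ [v]) (length q - 1)"
    using q H by (auto simp: collider_def nth_append numeral_2_eq_2)
  moreover have "H\<^sup>* `` {c} \<inter> C \<noteq> {}" using C by auto
  ultimately show ?thesis using active_reach_extend[OF q(1,2) C(2)] q H by auto
qed

text \<open>The witnessing paths leave \<open>Y\<close> against the arrows only, so in an acyclic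
  graph they have no colliders. They can be continued to further parents even when the endpoint has
  no descendant in \<open>C\<close>, where \<open>active_reach_backward\<close> does not
  apply.\<close>

definition back_reach :: "('n \<times> 'n) set \<Rightarrow> 'n set \<Rightarrow> 'n set \<Rightarrow> 'n set" where
  "back_reach H Y C = {v. v \<notin> C \<and> (\<exists>p. open_path H C p \<and> hd p \<in> Y \<and> last p = v \<and>
     successively (\<lambda>u v. (v, u) \<in> H) p)}"

lemma back_reach_subset: "back_reach H Y C \<subseteq> active_reach H Y C"
  by (auto simp: back_reach_def active_reach_def)

lemma back_reach_start: "v \<in> Y \<Longrightarrow> v \<notin> C \<Longrightarrow> v \<in> back_reach H Y C"
  by (auto simp: back_reach_def open_path_singleton intro!: exI[of _ "[v]"])

lemma back_reach_step:
  assumes u: "u \<in> back_reach H Y C" and v: "(v, u) \<in> H" "v \<notin> C" and acyc: "acyclic H"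
  shows "v \<in> back_reach H Y C"
proof -
  obtain p where p: "open_path H C p" "hd p \<in> Y" "last p = u" "successively (\<lambda>u v. (v, u) \<in> H) p"
    and uC: "u \<notin> C" using u by (auto simp: back_reach_def)
  have ne: "p \<noteq> []" using p by (auto simp: open_path_def undirected_path_def)
  show ?thesis
  proof (cases "v \<in> set p")
    case True
    then obtain k where k: "k < length p" "p ! k = v" by (auto simp: in_set_conv_nth)
    have "successively (\<lambda>u v. (v, u) \<in> H) (take (Suc k) p @ drop (Suc k) p)" using p by simp
    then have "successively (\<lambda>u v. (v, u) \<in> H) (take (Suc k) p)"
      unfolding successively_append_iff by blast
    moreover have "open_path H C (take (Suc k) p)" using p k by (intro open_path_take) auto
    moreover have "hd (take (Suc k) p) \<in> Y" using p(2) by simp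
    moreover have "last (take (Suc k) p) = v" using k by (simp add: take_Suc_conv_app_nth)
    ultimately show ?thesis using v(2) unfolding back_reach_def by blast
  next
    case False
    have s: "successively (\<lambda>u v. (v, u) \<in> H) (p @ [v])"
      using p(3,4) v(1) ne by (simp add: successively_append_iff)
    \<comment> \<open>The last step of \<open>p\<close> goes against an arrow out of
      \<open>last p\<close>; a collider there would give the opposite arrow as well, hence a
      cycle.\<close>
    have "\<not> collider H (p @ [v]) (length p - 1)"
    proof
      assume c: "collider H (p @ [v]) (length p - 1)"
      define j where "j = length p - 2"
      have j: "length p = Suc (Suc j)"
        using c by (auto simp: collider_def j_def)
      have "(p ! j, p ! Suc j) \<in> H" using c unfolding j by (auto simp: collider_def nth_append j)
      moreover have "(p ! Suc j, p ! j) \<in> H" using p(4) j by (simp add: successively_conv_nth)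
      ultimately show False using acyc by (meson acyclic_def r_into_trancl trancl_trans)
    qed
    then have "open_path H C (p @ [v])" using p uC v False by (intro open_path_snoc) auto
    moreover have "hd (p @ [v]) \<in> Y" "last (p @ [v]) = v" using p(2) ne by simp_all
    ultimately show ?thesis using s v(2) unfolding back_reach_def by blast
  qed
qed

lemma descendants_step: "(a, b) \<in> H \<Longrightarrow> H\<^sup>* `` {b} \<subseteq> H\<^sup>* `` {a}"
  by (auto intro: converse_rtrancl_into_rtrancl)

text \<open>All nodes on a directed path from \<open>v\<close> to \<open>y\<close> are descendants
  of \<open>v\<close>, hence outside \<open>C\<close>; read backwards from \<open>y\<close>, the
  path is open.\<close>

lemma back_reach_ancestor:
  assumes "(v, y) \<in> H\<^sup>*" "y \<in> Y" "H\<^sup>* `` {v} \<inter> C = {}" "acyclic H"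
  shows "v \<in> back_reach H Y C"
  using assms(1,3)
proof (induction rule: converse_rtrancl_induct)
  case base
  then show ?case using assms by (auto intro: back_reach_start)
next
  case (step v u)
  have "H\<^sup>* `` {u} \<inter> C = {}" using step.prems descendants_step[OF step.hyps(1)] by blast
  then have "u \<in> back_reach H Y C" by (rule step.IH)
  moreover have "v \<notin> C" using step.prems by blast
  ultimately show ?case using step.hyps(1) assms(4) by (blast intro: back_reach_step)
qed

text \<open>If \<open>c \<in> C\<close>, it is an open collider joining its parents. Otherwise
  \<open>c\<close> is reached from \<open>u\<close>, and a descendant of \<open>c\<close> in
  \<open>C\<close> opens the step to \<open>v\<close>. With no such descendant, forward steps reach
  \<open>t\<close>, which separation forces into \<open>Y\<close>; then \<open>c\<close> is reached
  backwards from \<open>Y\<close>, and the path goes on to \<open>v\<close>.\<close>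

lemma active_reach_family:
  assumes acyc: "acyclic H" and sep: "d_separated H Y Z C"
    and c: "(c, t) \<in> H\<^sup>*" "t \<in> Y \<union> Z \<union> C"
    and u: "u = c \<or> (u, c) \<in> H" "u \<in> active_reach H Y C"
    and v: "v = c \<or> (v, c) \<in> H" "v \<notin> C"
  shows "v \<in> active_reach H Y C"
proof (cases "c \<in> C")
  case True
  then have "(u, c) \<in> H" "(v, c) \<in> H" using u v by (auto simp: active_reach_def)
  then show ?thesis using active_reach_collider[OF u(2) _ _ True v(2) acyc] by blast
next
  case False
  then have cR: "c \<in> active_reach H Y C" using active_reach_forward[OF acyc u(2)] u by blast
  show ?thesis
  proof (cases "v = c")
    case False
    then have vc: "(v, c) \<in> H" using v by blast
    show ?thesis
    proof (cases "H\<^sup>* `` {c} \<inter> C = {}")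
      case True
      have "t \<in> active_reach H Y C" using c(1) True cR
      proof (induction rule: converse_rtrancl_induct)
        case (step a b)
        have "H\<^sup>* `` {b} \<inter> C = {}"
          using step.prems descendants_step[OF step.hyps(1)] by blast
        moreover from this have "b \<notin> C" by blast
        then have "b \<in> active_reach H Y C"
          by (rule active_reach_forward[OF acyc step.prems(2) step.hyps(1)])
        ultimately show ?case by (rule step.IH)
      qed
      then have "t \<in> Y" using c d_separated_active_reach[OF sep] by (auto simp: active_reach_def)
      then have "c \<in> back_reach H Y C" using back_reach_ancestor[OF c(1) _ True acyc] by blast
      then show ?thesis by (rule subsetD[OF back_reach_subset back_reach_step[OF _ vc v(2) acyc]])
    qed (rule active_reach_backward[OF cR vc v(2)])
  qed (use cR in blast)
qed

section \<open>Ancestral sets and their families\<close>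

definition ancestors :: "('n \<times> 'n) set \<Rightarrow> 'n set \<Rightarrow> 'n set" where
  "ancestors H B = {v. \<exists>t\<in>B. (v, t) \<in> H\<^sup>*}"

lemma ancestors_superset: "B \<subseteq> ancestors H B"
  by (auto simp: ancestors_def)

lemma ancestors_parent: "c \<in> ancestors H B \<Longrightarrow> (u, c) \<in> H \<Longrightarrow> u \<in> ancestors H B"
  by (auto simp: ancestors_def intro: converse_rtrancl_into_rtrancl)

lemma ancestors_subset:
  assumes "H \<subseteq> N \<times> N" "B \<subseteq> N"
  shows "ancestors H B \<subseteq> N"
proof
  fix v assume "v \<in> ancestors H B"
  then obtain t where "t \<in> B" "(v, t) \<in> H\<^sup>*" by (auto simp: ancestors_def)
  from this(2,1) show "v \<in> N" using assms by (cases rule: converse_rtranclE) auto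
qed

lemma active_reach_start: "v \<in> Y \<Longrightarrow> v \<notin> C \<Longrightarrow> v \<in> active_reach H Y C"
  by (rule subsetD[OF back_reach_subset back_reach_start])

lemma active_reach_disjoint: "C \<inter> active_reach H Y C = {}"
  by (auto simp: active_reach_def)

text \<open>This is what splits the factorization: a factor for \<open>c\<close> and its parents
  cannot involve both a node of \<open>active_reach H Y C\<close> and a node outside
  \<open>active_reach H Y C \<union> C\<close>.\<close>

lemma active_reach_family_cases:
  assumes "acyclic H" "d_separated H Y Z C" "c \<in> ancestors H (Y \<union> Z \<union> C)"
  shows "insert c {u. (u, c) \<in> H} \<inter> active_reach H Y C = {} \<or>
    insert c {u. (u, c) \<in> H} \<subseteq> active_reach H Y C \<union> C"
proof -
  obtain t where "(c, t) \<in> H\<^sup>*" "t \<in> Y \<union> Z \<union> C" using assms(3) by (auto simp: ancestors_def)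
  from active_reach_family[OF assms(1,2) this]
  have "v \<in> active_reach H Y C"
    if "u \<in> insert c {u. (u, c) \<in> H}" "u \<in> active_reach H Y C" "v \<in> insert c {u. (u, c) \<in> H}" "v \<notin> C"
    for u v using that by (metis insert_iff mem_Collect_eq)
  then show ?thesis by blast
qed

section \<open>Factorization over ancestral sets\<close>

text \<open>Gluing partial assignments is a bijection, and Tonelli turns the sum over pairs into a
  product of sums; values in \<open>ennreal\<close> dispense with summability.\<close>

lemma nn_integral_count_space_merge:
  fixes f g p :: "('n \<Rightarrow> 'v) \<Rightarrow> ennreal"
  assumes disj: "U \<inter> V = {}" and ext: "EU \<subseteq> extensional U" "EV \<subseteq> extensional V"
    and p: "\<And>u v. u \<in> EU \<Longrightarrow> v \<in> EV \<Longrightarrow> p (merge U V (u, v)) = f u * g v"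
  shows "(\<integral>\<^sup>+a. p a \<partial>count_space {a \<in> extensional (U \<union> V). restrict a U \<in> EU \<and> restrict a V \<in> EV})
    = (\<integral>\<^sup>+u. f u \<partial>count_space EU) * (\<integral>\<^sup>+v. g v \<partial>count_space EV)"
proof -
  let ?E = "{a \<in> extensional (U \<union> V). restrict a U \<in> EU \<and> restrict a V \<in> EV}"
  \<comment> \<open>The indicators move the sums to \<open>UNIV\<close>, the form in which
    \<open>nn_integral_fst_count_space\<close> applies.\<close>
  let ?f = "\<lambda>u. f u * indicator EU u" and ?g = "\<lambda>v. g v * indicator EV v"
  have "bij_betw (merge U V) (EU \<times> EV) ?E"
  proof (rule bij_betw_byWitness[where f' = "\<lambda>a. (restrict a U, restrict a V)"])
    show "\<forall>a\<in>EU \<times> EV. (restrict (merge U V a) U, restrict (merge U V a) V) = a"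
      using ext disj by (auto simp: extensional_restrict)
    show "\<forall>a\<in>?E. merge U V (restrict a U, restrict a V) = a"
      by (auto simp: extensional_restrict)
    show "merge U V ` (EU \<times> EV) \<subseteq> ?E"
      using ext disj by (auto simp: extensional_restrict)
    show "(\<lambda>a. (restrict a U, restrict a V)) ` ?E \<subseteq> EU \<times> EV" by auto
  qed
  then have "(\<integral>\<^sup>+a. p a \<partial>count_space ?E) = (\<integral>\<^sup>+a. p (merge U V a) \<partial>count_space (EU \<times> EV))"
    by (rule nn_integral_bij_count_space[symmetric])
  also have "\<dots> = (\<integral>\<^sup>+a. ?f (fst a) * ?g (snd a) \<partial>count_space UNIV)"
    by (subst nn_integral_count_space_indicator)
      (auto intro!: nn_integral_cong simp: p split: split_indicator)
  also have "\<dots> = (\<integral>\<^sup>+u. \<integral>\<^sup>+v. ?f u * ?g v \<partial>count_space UNIV \<partial>count_space UNIV)"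
    by (subst nn_integral_fst_count_space[symmetric]) simp
  also have "\<dots> = (\<integral>\<^sup>+u. ?f u \<partial>count_space UNIV) * (\<integral>\<^sup>+v. ?g v \<partial>count_space UNIV)"
    by (simp only: nn_integral_cmult nn_integral_multc borel_measurable_count_space)
  finally show ?thesis by (simp add: nn_integral_count_space_indicator)
qed

section \<open>Node factors and probabilities of pinned events\<close>

context causal_theory
begin

text \<open>This is P(a_i | pa_i), the factor of node \<open>i\<close> in the factorization of
  P.\<close>

definition weight :: "'n \<Rightarrow> ('n \<Rightarrow> 'v) \<Rightarrow> real" where
  "weight i a = \<P>(\<omega> in base T. mech T i (restrict a (parents T i)) (noise T i \<omega>) = a i)"

lemma weight_cong:
  assumes "\<And>j. j \<in> insert i (parents T i) \<Longrightarrow> a j = a' j"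
  shows "weight i a = weight i a'"
proof -
  have "restrict a (parents T i) = restrict a' (parents T i)"
    using assms by (intro restrict_ext) auto
  then show ?thesis using assms[of i] by (simp add: weight_def)
qed

lemma weight_nonneg: "0 \<le> weight i a"
  by (simp add: weight_def)

text \<open>An intervened node contributes the indicator of its imposed value, so both cases of the
  truncated factorization become one product.\<close>

definition node_factor :: "'n set \<Rightarrow> ('n \<Rightarrow> 'v) \<Rightarrow> 'n \<Rightarrow> ('n \<Rightarrow> 'v) \<Rightarrow> ennreal" where
  "node_factor S b i a = (if i \<in> S then (if a i = b i then 1 else 0) else ennreal (weight i a))"

text \<open>In the three rules \<open>b\<close> is a single assignment that agrees with \<open>x, y, z, w\<close> on
  \<open>X, Y, Z, W\<close>.\<close>

definition pinned :: "'n set \<Rightarrow> 'n set \<Rightarrow> ('n \<Rightarrow> 'v) \<Rightarrow> ('n \<Rightarrow> 'v) set" where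
  "pinned A B b = {a \<in> Pi\<^sub>E A (vals T). \<forall>i\<in>B. a i = b i}"

definition pin_prob :: "'n set \<Rightarrow> 'n set \<Rightarrow> ('n \<Rightarrow> 'v) \<Rightarrow> ennreal" where
  "pin_prob S B b = emeasure (joint (intervene T S b)) (pinned (nodes T) B b)"

lemma pin_prob_ancestral:
  assumes b: "\<And>i. i \<in> S \<Longrightarrow> b i \<in> vals T i" and A: "A \<subseteq> nodes T" and B: "B \<subseteq> A"
    and anc: "\<And>i. i \<in> A - S \<Longrightarrow> parents T i \<subseteq> A"
  shows "pin_prob S B b = (\<integral>\<^sup>+a. (\<Prod>i\<in>A. node_factor S b i a) \<partial>count_space (pinned A (B \<union> S \<inter> A) b))"
proof -
  let ?M = "intervene T S b"
  txt \<open>The mechanisms of \<open>S\<close> ignore their parents, so \<open>A\<close> carries a causal theory of its own,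
    whose solution is the restriction of the full one.\<close>
  let ?T = "?M\<lparr>nodes := A, arrows := {(u, v) \<in> arrows T. v \<in> A - S}\<rparr>"
  \<comment> \<open>\<open>causal_theory_intervene\<close> asks for an extensional value of
    \<open>S\<close>, which \<open>b\<close> need not be.\<close>
  have M_eq: "?M = intervene T S (restrict b S)"
    by (simp add: intervene_def cong: if_cong)
  interpret M: causal_theory ?M
    unfolding M_eq by (rule causal_theory_intervene) (use b in auto)
  have pa: "parents ?T i = (if i \<in> A - S then parents T i else {})" for i
    by (auto simp: parents_def)
  have mech: "mech ?T i p = (if i \<in> S then (\<lambda>e. b i) else mech T i p)" for i p
    by (auto simp: intervene_def)
  have same: "nodes ?M = nodes T" "vals ?M = vals T" "base ?M = base T" "noise ?M = noise T"
    "noise_space ?M = noise_space T" "arrows ?M = arrows T"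
    "mech ?M = (\<lambda>i. if i \<in> S then (\<lambda>p e. b i) else mech T i)" by (simp_all add: intervene_def)
  interpret A: causal_theory ?T
  proof (rule causal_theory.intro)
    show "finite (nodes ?T)" using A finite_nodes by (auto intro: finite_subset)
    show "arrows ?T \<subseteq> nodes ?T \<times> nodes ?T" using anc by (auto simp: parents_def)
    show "acyclic (arrows ?T)" by (rule acyclic_subset[OF acyclic_arrows]) auto
    show "countable (vals ?T i)" if "i \<in> nodes ?T" for i
      using that A countable_vals by (auto simp: same)
    show "prob_space (base ?T)" using prob_space_base by (simp add: same)
    show "prob_space.indep_vars (base ?T) (noise_space ?T) (noise ?T) (nodes ?T)"
      using prob_space.indep_vars_subset[OF prob_space_base indep_noise A] by (simp add: same)
    show "mech ?T i p \<in> measurable (noise_space ?T i) (count_space (vals ?T i))"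
      if i: "i \<in> nodes ?T" and p: "p \<in> Pi\<^sub>E (parents ?T i) (vals ?T)" for i p
    proof (cases "i \<in> S")
      case True
      then show ?thesis using b by (simp add: mech same)
    next
      case False
      then show ?thesis using i p A measurable_mech[of i p] unfolding mech pa by (auto simp: same)
    qed
  qed
  have sol: "solution ?T \<omega> = restrict (solution ?M \<omega>) A" for \<omega>
  proof -
    have s: "is_solution ?M \<omega> (solution ?M \<omega>)" by (rule M.is_solution_solution)
    have "is_solution ?T \<omega> (restrict (solution ?M \<omega>) A)"
      unfolding is_solution_def
    proof (intro conjI ballI)
      fix i assume "i \<in> nodes ?T"
      then have i: "i \<in> A" by simp
      show "restrict (solution ?M \<omega>) A i =
        mech ?T i (restrict (restrict (solution ?M \<omega>) A) (parents ?T i)) (noise ?T i \<omega>)"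
      proof (cases "i \<in> S")
        case True
        then have "solution ?M \<omega> i = b i"
          using s i A by (auto simp: is_solution_def intervene_def)
        then show ?thesis using i True unfolding mech by simp
      next
        case False
        have "restrict (restrict (solution ?M \<omega>) A) (parents T i) = restrict (solution ?M \<omega>) (parents T i)"
          using anc[of i] i False by (intro restrict_ext) auto
        moreover have "solution ?M \<omega> i = mech T i (restrict (solution ?M \<omega>) (parents T i)) (noise T i \<omega>)"
          using s i A False by (auto simp: is_solution_def intervene_def parents_def)
        ultimately show ?thesis using i False unfolding mech pa by (simp add: same)
      qed
    qed simp
    then show ?thesis unfolding A.solution_eq_iff .
  qed
  have "pin_prob S B b = emeasure (base T) (solution ?M -` pinned (nodes T) B b \<inter> space (base T))"
    unfolding pin_prob_def joint_def
    by (subst emeasure_distr[OF M.measurable_solution]) (auto simp: pinned_def same)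
  also have "solution ?M -` pinned (nodes T) B b \<inter> space (base T)
      = solution ?T -` pinned A B b \<inter> space (base T)"
  proof -
    have "solution ?M \<omega> \<in> pinned (nodes T) B b \<longleftrightarrow> solution ?T \<omega> \<in> pinned A B b"
      if "\<omega> \<in> space (base T)" for \<omega>
      using M.solution_in_PiE[of \<omega>] A.solution_in_PiE[of \<omega>] that B
      unfolding pinned_def sol by (auto simp: same)
    then show ?thesis by auto
  qed
  also have "emeasure (base T) \<dots> = emeasure (joint ?T) (pinned A B b)"
    unfolding joint_def using A.measurable_solution
    by (subst emeasure_distr) (auto simp: pinned_def same)
  also have "\<dots> = (\<integral>\<^sup>+a. emeasure (joint ?T) {a} \<partial>count_space (pinned A B b))"
  proof (rule emeasure_countable_singleton)
    show "countable (pinned A B b)"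
      by (rule countable_subset[OF _ A.countable_PiE_vals]) (auto simp: pinned_def same)
  qed (auto simp: joint_def pinned_def same)
  also have "\<dots> = (\<integral>\<^sup>+a. (\<Prod>i\<in>A. node_factor S b i a) \<partial>count_space (pinned A B b))"
  proof (rule nn_integral_cong)
    fix a assume "a \<in> space (count_space (pinned A B b))"
    then have a: "a \<in> Pi\<^sub>E A (vals T)" by (simp add: pinned_def)
    interpret J: prob_space "joint ?T" by (rule A.prob_space_joint)
    interpret B: prob_space "base T" by (rule prob_space_base)
    have "emeasure (joint ?T) {a} = ennreal (measure (joint ?T) {a})"
      by (rule J.emeasure_eq_measure)
    also have "measure (joint ?T) {a} = (\<Prod>i\<in>A. if i \<in> S then (if a i = b i then 1 else 0) else weight i a)"
    proof -
      have "a \<in> Pi\<^sub>E (nodes ?T) (vals ?T)" using a by (simp add: same)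
      \<comment> \<open>In \<open>?T\<close> an intervened node has a constant mechanism, so its
        probability is 0 or 1.\<close>
      from A.factorization[OF this] show ?thesis
        unfolding pa mech by (auto simp: same weight_def B.prob_space eq_commute intro!: prod.cong)
    qed
    also have "ennreal \<dots> = (\<Prod>i\<in>A. node_factor S b i a)"
      by (subst prod_ennreal[symmetric]) (auto simp: node_factor_def weight_nonneg intro!: prod.cong)
    finally show "emeasure (joint ?T) {a} = (\<Prod>i\<in>A. node_factor S b i a)" .
  qed
  \<comment> \<open>Assignments that disagree with \<open>b\<close> on \<open>S \<inter> A\<close>
    have a factor 0, so the sum may be confined to those that agree.\<close>
  also have "\<dots> = (\<integral>\<^sup>+a. (\<Prod>i\<in>A. node_factor S b i a) \<partial>count_space (pinned A (B \<union> S \<inter> A) b))"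
  proof (rule nn_integral_count_space_eq)
    fix a assume "a \<in> pinned A B b - pinned A (B \<union> S \<inter> A) b"
    then obtain i where "i \<in> S \<inter> A" "a i \<noteq> b i" by (auto simp: pinned_def)
    then show "(\<Prod>i\<in>A. node_factor S b i a) = 0"
      using A finite_nodes by (intro prod_zero) (auto simp: node_factor_def intro: finite_subset)
  qed (auto simp: pinned_def)
  finally show ?thesis .
qed

text \<open>\<open>I\<close> collects the factors of the \<open>U\<close> side: they read only
  \<open>U\<close> and \<open>D\<close>, and the values on \<open>D\<close> are pinned by
  observation or intervention. The remaining factors read \<open>A - U\<close> only, so
  \<open>nn_integral_count_space_merge\<close> applies.\<close>

lemma pin_prob_split:
  assumes b: "\<And>i. i \<in> S \<Longrightarrow> b i \<in> vals T i" and A: "A \<subseteq> nodes T"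
    and anc: "\<And>i. i \<in> A - S \<Longrightarrow> parents T i \<subseteq> A"
    and U: "U \<subseteq> A" "Y \<subseteq> U" "S \<inter> U = {}" and B: "B \<subseteq> A - U" and D: "D \<subseteq> B \<union> S" "D \<subseteq> A"
    and I: "I \<subseteq> A - S" "\<And>i. i \<in> I \<Longrightarrow> insert i (parents T i) \<subseteq> U \<union> D"
    and J: "\<And>i. i \<in> A - I - S \<Longrightarrow> insert i (parents T i) \<inter> U = {}"
  shows "pin_prob S (Y \<union> B) b =
    (\<integral>\<^sup>+u. (\<Prod>i\<in>I. ennreal (weight i (\<lambda>j. if j \<in> U then u j else b j))) \<partial>count_space (pinned U Y b)) *
    (\<integral>\<^sup>+v. (\<Prod>i\<in>A - I. node_factor S b i v) \<partial>count_space (pinned (A - U) (B \<union> S \<inter> A) b))"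
proof -
  have UA: "U \<union> (A - U) = A" using U by blast
  have "pin_prob S (Y \<union> B) b =
      (\<integral>\<^sup>+a. (\<Prod>i\<in>A. node_factor S b i a) \<partial>count_space (pinned A (Y \<union> B \<union> S \<inter> A) b))"
    using U B by (intro pin_prob_ancestral b A anc) auto
  also have "pinned A (Y \<union> B \<union> S \<inter> A) b = {a \<in> extensional (U \<union> (A - U)).
      restrict a U \<in> pinned U Y b \<and> restrict a (A - U) \<in> pinned (A - U) (B \<union> S \<inter> A) b}" (is "?L = ?R")
  proof
    show "?L \<subseteq> ?R"
    proof
      fix a assume a: "a \<in> ?L"
      have "a i = b i" if "i \<in> B \<union> S \<inter> A \<union> Y" for i using a that by (auto simp: pinned_def)
      moreover have "a i \<in> vals T i" if "i \<in> A" for i using a that by (auto simp: pinned_def)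
      moreover have "a \<in> extensional A" using a by (auto simp: pinned_def PiE_def)
      ultimately show "a \<in> ?R" using U B unfolding UA pinned_def by (auto simp: restrict_def)
    qed
    show "?R \<subseteq> ?L"
    proof
      fix a assume a: "a \<in> ?R"
      have y: "a i = b i" if "i \<in> Y" for i
        using a that U by (auto simp: pinned_def restrict_def split: if_splits)
      have bs: "a i = b i" if i: "i \<in> B \<union> S \<inter> A" for i
      proof -
        have "i \<in> A - U" using i U B by blast
        moreover have "restrict a (A - U) i = b i" using a i unfolding pinned_def by blast
        ultimately show ?thesis by simp
      qed
      have v: "a i \<in> vals T i" if i: "i \<in> A" for i
      proof (cases "i \<in> U")
        case True
        then have "restrict a U i \<in> vals T i" using a by (auto simp: pinned_def)
        then show ?thesis using True by simp
      next
        case False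
        then have "restrict a (A - U) i \<in> vals T i" using a i by (auto simp: pinned_def PiE_iff)
        then show ?thesis using False i by simp
      qed
      show "a \<in> ?L" using a y bs v unfolding UA by (auto simp: pinned_def PiE_iff)
    qed
  qed
  also have "(\<integral>\<^sup>+a. (\<Prod>i\<in>A. node_factor S b i a) \<partial>count_space ?R) =
    (\<integral>\<^sup>+u. (\<Prod>i\<in>I. ennreal (weight i (\<lambda>j. if j \<in> U then u j else b j))) \<partial>count_space (pinned U Y b)) *
    (\<integral>\<^sup>+v. (\<Prod>i\<in>A - I. node_factor S b i v) \<partial>count_space (pinned (A - U) (B \<union> S \<inter> A) b))"
  proof (rule nn_integral_count_space_merge)
    show "pinned U Y b \<subseteq> extensional U" "pinned (A - U) (B \<union> S \<inter> A) b \<subseteq> extensional (A - U)"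
      by (auto simp: pinned_def PiE_def)
    fix u v assume u: "u \<in> pinned U Y b" and v: "v \<in> pinned (A - U) (B \<union> S \<inter> A) b"
    let ?m = "merge U (A - U) (u, v)"
    have m: "?m i = u i" if "i \<in> U" for i using that by simp
    have m': "?m i = v i" if "i \<in> A - U" for i using that by simp
    have "(\<Prod>i\<in>A. node_factor S b i ?m) = (\<Prod>i\<in>A - I. node_factor S b i ?m) * (\<Prod>i\<in>I. node_factor S b i ?m)"
      using I A finite_nodes by (intro prod.subset_diff) (auto intro: finite_subset)
    also have "(\<Prod>i\<in>I. node_factor S b i ?m) = (\<Prod>i\<in>I. ennreal (weight i (\<lambda>j. if j \<in> U then u j else b j)))"
    proof (rule prod.cong)
      fix i assume i: "i \<in> I"
      have "weight i ?m = weight i (\<lambda>j. if j \<in> U then u j else b j)"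
      proof (rule weight_cong)
        fix j assume "j \<in> insert i (parents T i)"
        then have "j \<in> U \<or> j \<in> D" using I(2)[OF i] by blast
        moreover have "?m j = b j" if "j \<in> D" "j \<notin> U"
        proof -
          have "j \<in> A - U" "j \<in> B \<union> S \<inter> A" using that D by auto
          then show ?thesis using v m' by (auto simp: pinned_def)
        qed
        ultimately show "?m j = (if j \<in> U then u j else b j)" using m by auto
      qed
      then show "node_factor S b i ?m = ennreal (weight i (\<lambda>j. if j \<in> U then u j else b j))"
        using i I by (auto simp: node_factor_def)
    qed simp
    also have "(\<Prod>i\<in>A - I. node_factor S b i ?m) = (\<Prod>i\<in>A - I. node_factor S b i v)"
    proof (rule prod.cong)
      fix i assume i: "i \<in> A - I"
      show "node_factor S b i ?m = node_factor S b i v"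
      proof (cases "i \<in> S")
        \<comment> \<open>The factor of an intervened node reads only its own value, so its parents
          may lie in \<open>U\<close>.\<close>
        case True
        then have "i \<in> A - U" using i U by blast
        then show ?thesis using True by (simp add: node_factor_def)
      next
        case False
        have "weight i ?m = weight i v"
        proof (rule weight_cong)
          fix j assume "j \<in> insert i (parents T i)"
          then have "j \<in> A - U" using J[of i] anc[of i] i False by blast
          then show "?m j = v j" by (rule m')
        qed
        then show ?thesis using False by (simp add: node_factor_def)
      qed
    qed simp
    finally show "(\<Prod>i\<in>A. node_factor S b i ?m) =
        (\<Prod>i\<in>I. ennreal (weight i (\<lambda>j. if j \<in> U then u j else b j))) * (\<Prod>i\<in>A - I. node_factor S b i v)"
      by (simp add: mult.commute)
  qed blast
  finally show ?thesis .
qed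

text \<open>The first factor of \<open>pin_prob_split\<close> does not depend on \<open>S\<close> and \<open>B\<close>, the second not
  on \<open>Y\<close>. The equality of conditional probabilities is stated as a cross product, which
  needs neither positivity nor finiteness.\<close>

lemma pin_prob_cross:
  assumes b: "\<And>i. i \<in> S \<union> S' \<Longrightarrow> b i \<in> vals T i" and A: "A \<subseteq> nodes T"
    and anc: "\<And>i. i \<in> A - S \<inter> S' \<Longrightarrow> parents T i \<subseteq> A"
    and U: "U \<subseteq> A" "Y \<subseteq> U" "(S \<union> S') \<inter> U = {}" and B: "B \<subseteq> A - U" "B' \<subseteq> A - U"
    and D: "D \<subseteq> B \<union> S" "D \<subseteq> B' \<union> S'" "D \<subseteq> A"
    and fam: "\<And>i. i \<in> A - (S \<union> S') \<Longrightarrow> insert i (parents T i) \<inter> U = {} \<or> insert i (parents T i) \<subseteq> U \<union> D"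
    and diff: "\<And>i. i \<in> A \<inter> (S \<union> S') - S \<inter> S' \<Longrightarrow> insert i (parents T i) \<inter> U = {}"
  shows "pin_prob S (Y \<union> B) b * pin_prob S' B' b = pin_prob S' (Y \<union> B') b * pin_prob S B b"
proof -
  \<comment> \<open>The factors touching \<open>U\<close>, taken outside both \<open>S\<close> and
    \<open>S'\<close> so that \<open>?F\<close> is the same for both distributions. By
    \<open>diff\<close>, the weight of a node intervened on in only one of them does not read
    \<open>U\<close> and can go into \<open>?G\<close>.\<close>
  let ?I = "{i \<in> A - (S \<union> S'). insert i (parents T i) \<inter> U \<noteq> {}}"
  let ?F = "\<lambda>Y. \<integral>\<^sup>+u. (\<Prod>i\<in>?I. ennreal (weight i (\<lambda>j. if j \<in> U then u j else b j))) \<partial>count_space (pinned U Y b)"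
  let ?G = "\<lambda>S B. \<integral>\<^sup>+v. (\<Prod>i\<in>A - ?I. node_factor S b i v) \<partial>count_space (pinned (A - U) (B \<union> S \<inter> A) b)"
  have 1: "pin_prob S (Q \<union> B) b = ?F Q * ?G S B" if "Q \<subseteq> U" for Q
  proof (rule pin_prob_split)
    fix i assume "i \<in> ?I" then show "insert i (parents T i) \<subseteq> U \<union> D" using fam[of i] by blast
  next
    fix i assume "i \<in> A - ?I - S" then show "insert i (parents T i) \<inter> U = {}" using diff[of i] by blast
  qed (use that b A anc U B D in auto)
  have 2: "pin_prob S' (Q \<union> B') b = ?F Q * ?G S' B'" if "Q \<subseteq> U" for Q
  proof (rule pin_prob_split)
    fix i assume "i \<in> ?I" then show "insert i (parents T i) \<subseteq> U \<union> D" using fam[of i] by blast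
  next
    fix i assume "i \<in> A - ?I - S'" then show "insert i (parents T i) \<inter> U = {}" using diff[of i] by blast
  qed (use that b A anc U B D in auto)
  \<comment> \<open>The denominators carry no event on \<open>Y\<close>: they are the case
    \<open>Q = {}\<close>.\<close>
  have 3: "pin_prob S B b = ?F {} * ?G S B" "pin_prob S' B' b = ?F {} * ?G S' B'"
    using 1[of "{}"] 2[of "{}"] by simp_all
  show ?thesis
    unfolding 1[OF U(2)] 2[OF U(2)] 3 by (simp only: ac_simps)
qed

end

section \<open>The three rules\<close>

context causal_theory
begin

lemma acyclic_cut: "H \<subseteq> arrows T \<Longrightarrow> acyclic H"
  by (rule acyclic_subset[OF acyclic_arrows])

text \<open>Both distributions intervene on \<open>X\<close>; the terms differ in pinning
  \<open>Z\<close>, which lies outside \<open>U\<close> and so affects only the cancelling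
  factor.\<close>

lemma pin_prob_rule1:
  assumes sub: "X \<subseteq> nodes T" "Y \<subseteq> nodes T" "Z \<subseteq> nodes T" "W \<subseteq> nodes T"
    and disj: "X \<inter> Y = {}" "X \<inter> Z = {}" "Y \<inter> W = {}" "Z \<inter> W = {}" "Y \<inter> Z = {}"
    and b: "\<And>i. i \<in> X \<Longrightarrow> b i \<in> vals T i"
    and sep: "d_separated (cut_into X (arrows T)) Y Z (X \<union> W)"
  shows "pin_prob X (Y \<union> (Z \<union> W)) b * pin_prob X W b = pin_prob X (Y \<union> W) b * pin_prob X (Z \<union> W) b"
proof -
  let ?H = "cut_into X (arrows T)" and ?C = "X \<union> W"
  let ?A = "ancestors ?H (Y \<union> Z \<union> ?C)" and ?R = "active_reach ?H Y ?C"
  have H: "?H \<subseteq> arrows T" by (auto simp: cut_into_def)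
  have pa: "{u. (u, i) \<in> ?H} = parents T i" if "i \<notin> X" for i
    using that by (auto simp: cut_into_def parents_def)
  have sup: "Y \<union> Z \<union> ?C \<subseteq> ?A" by (rule ancestors_superset)
  have RZ: "Z \<inter> ?R = {}" by (rule d_separated_active_reach[OF sep])
  have RC: "?C \<inter> ?R = {}" by (rule active_reach_disjoint)
  have RY: "Y \<subseteq> ?R" using disj active_reach_start[of _ Y ?C ?H] by blast
  have anc: "parents T i \<subseteq> ?A" if "i \<in> ?A" "i \<notin> X" for i
    using ancestors_parent[OF that(1)] pa[OF that(2)] by blast
  show ?thesis
  proof (rule pin_prob_cross[where A = ?A and U = "?R \<inter> ?A" and D = ?C])
    show "?A \<subseteq> nodes T" using H arrows_nodes sub by (intro ancestors_subset) auto
    fix i assume i: "i \<in> ?A - (X \<union> X)"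
    then show "insert i (parents T i) \<inter> (?R \<inter> ?A) = {} \<or> insert i (parents T i) \<subseteq> (?R \<inter> ?A) \<union> ?C"
      using active_reach_family_cases[OF acyclic_cut[OF H] sep, of i] pa[of i] anc[of i] by auto
  qed (use b anc sup RZ RC RY in auto)
qed

text \<open>\<open>Z\<close> is pinned on both sides, by action on one and by observation on the
  other, so it may join \<open>D\<close>; this accounts for the parents in \<open>Z\<close> that the
  cut graph does not see. The weights of \<open>Z\<close> itself occur only under observation and,
  not reading \<open>U\<close>, belong to the cancelling factor.\<close>

lemma pin_prob_rule2:
  assumes sub: "X \<subseteq> nodes T" "Y \<subseteq> nodes T" "Z \<subseteq> nodes T" "W \<subseteq> nodes T"
    and disj: "X \<inter> Y = {}" "X \<inter> Z = {}" "Y \<inter> W = {}" "Z \<inter> W = {}" "Y \<inter> Z = {}"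
    and b: "\<And>i. i \<in> X \<union> Z \<Longrightarrow> b i \<in> vals T i"
    and sep: "d_separated (cut_out_of Z (cut_into X (arrows T))) Y Z (X \<union> W)"
  shows "pin_prob (X \<union> Z) (Y \<union> W) b * pin_prob X (Z \<union> W) b
    = pin_prob X (Y \<union> (Z \<union> W)) b * pin_prob (X \<union> Z) W b"
proof -
  let ?H = "cut_out_of Z (cut_into X (arrows T))" and ?C = "X \<union> W"
  let ?A = "ancestors ?H (Y \<union> Z \<union> ?C)" and ?R = "active_reach ?H Y ?C"
  have H: "?H \<subseteq> arrows T" by (auto simp: cut_into_def cut_out_of_def)
  have pa: "{u. (u, i) \<in> ?H} = parents T i - Z" if "i \<notin> X" for i
    using that by (auto simp: cut_into_def cut_out_of_def parents_def)
  have sup: "Y \<union> Z \<union> ?C \<subseteq> ?A" by (rule ancestors_superset)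
  have RZ: "Z \<inter> ?R = {}" by (rule d_separated_active_reach[OF sep])
  have RC: "?C \<inter> ?R = {}" by (rule active_reach_disjoint)
  have RY: "Y \<subseteq> ?R" using disj active_reach_start[of _ Y ?C ?H] by blast
  \<comment> \<open>Arrows out of \<open>Z\<close> are missing from \<open>?H\<close>; parents in
    \<open>Z\<close> still lie in \<open>?A\<close>, which is generated by \<open>Z\<close>
    too.\<close>
  have anc: "parents T i \<subseteq> ?A" if "i \<in> ?A" "i \<notin> X" for i
    using ancestors_parent[OF that(1)] pa[OF that(2)] sup by blast
  have fam: "insert i (parents T i) \<inter> ?R = {} \<or> insert i (parents T i) \<subseteq> ?R \<union> (?C \<union> Z)"
    if "i \<in> ?A" "i \<notin> X" for i
    using active_reach_family_cases[OF acyclic_cut[OF H] sep that(1)] RZ unfolding pa[OF that(2)] by blast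
  show ?thesis
  proof (rule pin_prob_cross[where A = ?A and U = "?R \<inter> ?A" and D = "?C \<union> Z"])
    show "?A \<subseteq> nodes T" using H arrows_nodes sub by (intro ancestors_subset) auto
    fix i assume i: "i \<in> ?A - (X \<union> Z \<union> X)"
    then show "insert i (parents T i) \<inter> (?R \<inter> ?A) = {} \<or> insert i (parents T i) \<subseteq> (?R \<inter> ?A) \<union> (?C \<union> Z)"
      using fam[of i] anc[of i] by auto
  next
    fix i assume "i \<in> ?A \<inter> (X \<union> Z \<union> X) - (X \<union> Z) \<inter> X"
    then have i: "i \<in> ?A" "i \<notin> X" "i \<in> Z" by auto
    then have "i \<notin> ?R" "i \<notin> ?C" using RZ disj by auto
    then have "insert i (parents T i - Z) \<inter> ?R = {}"
      using active_reach_family_cases[OF acyclic_cut[OF H] sep i(1)] unfolding pa[OF i(2)] by blast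
    then show "insert i (parents T i) \<inter> (?R \<inter> ?A) = {}" using RZ by blast
  qed (use b anc sup RZ RC RY in auto)
qed

text \<open>The extra cut removes only arrows into \<open>?N\<close>, which \<open>?A\<close>
  misses, so on \<open>?A\<close> the graphs \<open>?H\<close> and \<open>?G\<close> have the same
  families. A node of \<open>Z\<close> left in \<open>?A\<close> is outside \<open>?R\<close> and
  \<open>?C\<close>; its family misses \<open>?R\<close>, so its weight belongs to the cancelling
  factor.\<close>

lemma pin_prob_rule3:
  assumes sub: "X \<subseteq> nodes T" "Y \<subseteq> nodes T" "Z \<subseteq> nodes T" "W \<subseteq> nodes T"
    and disj: "X \<inter> Y = {}" "X \<inter> Z = {}" "Y \<inter> W = {}" "Z \<inter> W = {}" "Y \<inter> Z = {}"
    and b: "\<And>i. i \<in> X \<union> Z \<Longrightarrow> b i \<in> vals T i"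
    and sep: "d_separated (cut_into (non_ancestors (cut_into X (arrows T)) Z W) (cut_into X (arrows T))) Y Z (X \<union> W)"
  shows "pin_prob (X \<union> Z) (Y \<union> W) b * pin_prob X W b = pin_prob X (Y \<union> W) b * pin_prob (X \<union> Z) W b"
proof -
  let ?G = "cut_into X (arrows T)" and ?C = "X \<union> W"
  let ?N = "non_ancestors ?G Z W"
  let ?H = "cut_into ?N ?G"
  let ?A = "ancestors ?G (Y \<union> ?C)" and ?R = "active_reach ?H Y ?C"
  have H: "?H \<subseteq> arrows T" by (auto simp: cut_into_def)
  have acyc: "acyclic ?H" by (rule acyclic_cut[OF H])
  have pa: "{u. (u, i) \<in> ?G} = parents T i" if "i \<notin> X" for i
    using that by (auto simp: cut_into_def parents_def)
  have sup: "Y \<union> ?C \<subseteq> ?A" by (rule ancestors_superset)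
  have RZ: "Z \<inter> ?R = {}" by (rule d_separated_active_reach[OF sep])
  have RC: "?C \<inter> ?R = {}" by (rule active_reach_disjoint)
  have RY: "Y \<subseteq> ?R" using disj active_reach_start[of _ Y ?C ?H] by blast
  have anc: "parents T i \<subseteq> ?A" if "i \<in> ?A" "i \<notin> X" for i
    using ancestors_parent[OF that(1)] pa[OF that(2)] by blast
  \<comment> \<open>Walking back from \<open>y\<close>, every node reached is in \<open>?R\<close>,
    hence not in \<open>Z\<close>, so the arrow into it survives in \<open>?H\<close>. Only the
    starting point \<open>v\<close> can be in \<open>X\<close>, since no arrow of \<open>?G\<close>
    enters \<open>X\<close>.\<close>
  have reach: "v \<in> X \<or> v \<in> back_reach ?H Y ?C"
    if "(v, y) \<in> ?G\<^sup>*" "?G\<^sup>* `` {v} \<inter> W = {}" "y \<in> Y" for v y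
    using that(1,2)
  proof (induction rule: converse_rtrancl_induct)
    case base
    then show ?case using that(3) disj back_reach_start[of y Y ?C ?H] by blast
  next
    case (step v u)
    have "?G\<^sup>* `` {u} \<inter> W = {}" using step.prems descendants_step[OF step.hyps(1)] by blast
    moreover have "u \<notin> X" using step.hyps(1) by (auto simp: cut_into_def)
    ultimately have u: "u \<in> back_reach ?H Y ?C" using step.IH by blast
    then have "u \<in> ?R" by (rule subsetD[OF back_reach_subset])
    then have "u \<notin> ?N" using RZ by (auto simp: non_ancestors_def)
    then have "(v, u) \<in> ?H" using step.hyps(1) by (auto simp: cut_into_def)
    moreover have "v \<notin> W" using step.prems by blast
    ultimately show ?case using back_reach_step[OF u _ _ acyc] by blast
  qed
  txt \<open>A node of \<open>?N\<close> with a directed path to \<open>Y\<close> would be connected to \<open>Y\<close> by an open path: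
    the path avoids \<open>W\<close> since the node is no ancestor of \<open>W\<close>.\<close>
  have NA: "?N \<inter> ?A = {}"
  proof (rule ccontr)
    assume "?N \<inter> ?A \<noteq> {}"
    then obtain v t where v: "v \<in> Z" "\<And>w. w \<in> W \<Longrightarrow> (v, w) \<notin> ?G\<^sup>*" and t: "t \<in> Y \<union> ?C" "(v, t) \<in> ?G\<^sup>*"
      by (auto simp: non_ancestors_def ancestors_def)
    have vX: "v \<notin> X" using v(1) disj by blast
    \<comment> \<open>No arrow of \<open>?G\<close> enters \<open>X\<close>, so
      \<open>t \<in> X\<close> would force \<open>t = v\<close>.\<close>
    have "t \<notin> X"
    proof
      assume "t \<in> X"
      moreover have "t = v \<or> (\<exists>u. (u, t) \<in> ?G)" using t(2) by (auto elim: rtranclE)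
      ultimately show False using vX by (auto simp: cut_into_def)
    qed
    then have "t \<in> Y" using t v(2) by blast
    moreover have "?G\<^sup>* `` {v} \<inter> W = {}" using v(2) by blast
    ultimately have "v \<in> back_reach ?H Y ?C" using reach[OF t(2)] vX by blast
    then have "v \<in> ?R" by (rule subsetD[OF back_reach_subset])
    then show False using v(1) RZ by blast
  qed
  have AH: "i \<in> ancestors ?H (Y \<union> Z \<union> ?C)" if i: "i \<in> ?A" for i
  proof -
    obtain t where t: "t \<in> Y \<union> ?C" "(i, t) \<in> ?G\<^sup>*" using i by (auto simp: ancestors_def)
    \<comment> \<open>The whole directed path to \<open>t\<close> stays in \<open>?A\<close>, so
      none of its arrows is cut.\<close>
    have "(i, t) \<in> ?H\<^sup>*" using t(2)
    proof (induction rule: converse_rtrancl_induct)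
      case (step v u)
      have "u \<in> ?A" using step.hyps(2) t(1) by (auto simp: ancestors_def)
      then have "(v, u) \<in> ?H" using NA step.hyps(1) by (auto simp: cut_into_def)
      then show ?case using step.IH by (rule converse_rtrancl_into_rtrancl)
    qed simp
    then show ?thesis using t(1) by (auto simp: ancestors_def)
  qed
  have paH: "{u. (u, i) \<in> ?H} = parents T i" if "i \<in> ?A" "i \<notin> X" for i
    using that NA pa[OF that(2)] by (auto simp: cut_into_def)
  have fam: "insert i (parents T i) \<inter> ?R = {} \<or> insert i (parents T i) \<subseteq> ?R \<union> ?C"
    if "i \<in> ?A" "i \<notin> X" for i
    using active_reach_family_cases[OF acyc sep AH[OF that(1)]] unfolding paH[OF that] .
  show ?thesis
  proof (rule pin_prob_cross[where A = ?A and U = "?R \<inter> ?A" and D = ?C])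
    have "?G \<subseteq> arrows T" by (auto simp: cut_into_def)
    then show "?A \<subseteq> nodes T" using arrows_nodes sub by (intro ancestors_subset) auto
    fix i assume i: "i \<in> ?A - (X \<union> Z \<union> X)"
    then show "insert i (parents T i) \<inter> (?R \<inter> ?A) = {} \<or> insert i (parents T i) \<subseteq> (?R \<inter> ?A) \<union> ?C"
      using fam[of i] anc[of i] by auto
  next
    fix i assume "i \<in> ?A \<inter> (X \<union> Z \<union> X) - (X \<union> Z) \<inter> X"
    then have i: "i \<in> ?A" "i \<notin> X" "i \<in> Z" by auto
    then have "i \<notin> ?R" "i \<notin> ?C" using RZ disj by auto
    then show "insert i (parents T i) \<inter> (?R \<inter> ?A) = {}" using fam[OF i(1,2)] by blast
  qed (use b anc sup RZ RC RY in auto)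
qed

section \<open>From cross products to conditional probabilities\<close>

text \<open>An intervention reads only the values on \<open>S\<close>, so \<open>s\<close> may be
  replaced by the common assignment \<open>b\<close>.\<close>

lemma prob_intervene:
  assumes s: "s \<in> Pi\<^sub>E S (vals T)" "\<And>i. i \<in> S \<Longrightarrow> s i = b i"
    and Q: "\<And>v. Q v \<longleftrightarrow> (\<forall>i\<in>B. v i = b i)"
  shows "ennreal (\<P>(v in joint (intervene T S s). Q v)) = pin_prob S B b"
proof -
  interpret M: causal_theory "intervene T S s" by (rule causal_theory_intervene[OF s(1)])
  interpret J: prob_space "joint (intervene T S s)" by (rule M.prob_space_joint)
  have "{v \<in> space (joint (intervene T S s)). Q v} = pinned (nodes T) B b"
    by (auto simp: joint_def pinned_def Q intervene_def)
  moreover have "intervene T S s = intervene T S b"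
    using s(2) by (simp add: intervene_def cong: if_cong)
  ultimately show ?thesis unfolding pin_prob_def by (metis J.emeasure_eq_measure)
qed

text \<open>Once the \<open>ennreal\<close> identity is brought back to the reals, positivity of
  both conditioning events allows dividing the cross product.\<close>

lemma cond_prob_intervene:
  assumes s: "s \<in> Pi\<^sub>E S (vals T)" "\<And>i. i \<in> S \<Longrightarrow> s i = b i"
    and s': "s' \<in> Pi\<^sub>E S' (vals T)" "\<And>i. i \<in> S' \<Longrightarrow> s' i = b i"
    and Q: "\<And>v. Q v \<longleftrightarrow> (\<forall>i\<in>Y. v i = b i)"
    and R: "\<And>v. R v \<longleftrightarrow> (\<forall>i\<in>B. v i = b i)" "\<And>v. R' v \<longleftrightarrow> (\<forall>i\<in>B'. v i = b i)"
    and pos: "\<P>(v in joint (intervene T S s). R v) > 0" "\<P>(v in joint (intervene T S' s'). R' v) > 0"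
    and cross: "pin_prob S (Y \<union> B) b * pin_prob S' B' b = pin_prob S' (Y \<union> B') b * pin_prob S B b"
  shows "\<P>(v in joint (intervene T S s). Q v \<bar> R v) = \<P>(v in joint (intervene T S' s'). Q v \<bar> R' v)"
proof -
  let ?p = "\<lambda>R. \<P>(v in joint (intervene T S s). R v)" and ?p' = "\<lambda>R. \<P>(v in joint (intervene T S' s'). R v)"
  have "ennreal (?p (\<lambda>v. Q v \<and> R v)) = pin_prob S (Y \<union> B) b" "ennreal (?p R) = pin_prob S B b"
    by (rule prob_intervene[OF s], auto simp: Q R)+
  moreover have "ennreal (?p' (\<lambda>v. Q v \<and> R' v)) = pin_prob S' (Y \<union> B') b" "ennreal (?p' R') = pin_prob S' B' b"
    by (rule prob_intervene[OF s'], auto simp: Q R)+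
  ultimately have "ennreal (?p (\<lambda>v. Q v \<and> R v) * ?p' R') = ennreal (?p' (\<lambda>v. Q v \<and> R' v) * ?p R)"
    using cross by (simp add: ennreal_mult)
  then have "?p (\<lambda>v. Q v \<and> R v) * ?p' R' = ?p' (\<lambda>v. Q v \<and> R' v) * ?p R"
    by (subst (asm) ennreal_inj) auto
  then show ?thesis using pos unfolding cond_prob_def by (simp add: frac_eq_eq)
qed

end

theorem theorem3p1:
  fixes T :: "('n, 'v, 'w, 'e) structural_model"
    and X Y Z W :: "'n set" and x y z w :: "'n \<Rightarrow> 'v"
  assumes "causal_theory T"
    and "X \<subseteq> nodes T" "Y \<subseteq> nodes T" "Z \<subseteq> nodes T" "W \<subseteq> nodes T"
    and "X \<inter> Y = {}" "X \<inter> Z = {}" "X \<inter> W = {}" "Y \<inter> Z = {}" "Y \<inter> W = {}" "Z \<inter> W = {}"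
    and "x \<in> Pi\<^sub>E X (vals T)" "y \<in> Pi\<^sub>E Y (vals T)" "z \<in> Pi\<^sub>E Z (vals T)" "w \<in> Pi\<^sub>E W (vals T)"
  shows "let
      G_X = cut_into X (arrows T);
      P_x = joint (intervene T X x);
      P_xz = joint (intervene T (X \<union> Z) (merge X Z (x, z)))
    in
      (d_separated G_X Y Z (X \<union> W) \<and>
        \<P>(v in P_x. restrict v Z = z \<and> restrict v W = w) > 0 \<and>
        \<P>(v in P_x. restrict v W = w) > 0 \<longrightarrow>
          \<P>(v in P_x. restrict v Y = y \<bar> restrict v Z = z \<and> restrict v W = w)
            = \<P>(v in P_x. restrict v Y = y \<bar> restrict v W = w)) \<and>
      (d_separated (cut_out_of Z G_X) Y Z (X \<union> W) \<and>
        \<P>(v in P_xz. restrict v W = w) > 0 \<and>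
        \<P>(v in P_x. restrict v Z = z \<and> restrict v W = w) > 0 \<longrightarrow>
          \<P>(v in P_xz. restrict v Y = y \<bar> restrict v W = w)
            = \<P>(v in P_x. restrict v Y = y \<bar> restrict v Z = z \<and> restrict v W = w)) \<and>
      (d_separated (cut_into (non_ancestors G_X Z W) G_X) Y Z (X \<union> W) \<and>
        \<P>(v in P_xz. restrict v W = w) > 0 \<and>
        \<P>(v in P_x. restrict v W = w) > 0 \<longrightarrow>
          \<P>(v in P_xz. restrict v Y = y \<bar> restrict v W = w)
            = \<P>(v in P_x. restrict v Y = y \<bar> restrict v W = w))"
proof -
  interpret causal_theory T by (rule assms(1))
  \<comment> \<open>One assignment agrees with all four values; disjointness makes the order of the
    cases immaterial.\<close>
  define b where "b i = (if i \<in> X then x i else if i \<in> Y then y i else if i \<in> Z then z i else w i)" for i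
  have bx: "x i = b i" if "i \<in> X" for i using that by (simp add: b_def)
  have bY: "b i = y i" if "i \<in> Y" for i using that assms(6) by (auto simp: b_def)
  have bz: "b i = z i" if "i \<in> Z" for i using that assms(7,9) by (auto simp: b_def)
  have bw: "b i = w i" if "i \<in> W" for i using that assms(8,10,11) by (auto simp: b_def)
  have pin: "restrict v B = c \<longleftrightarrow> (\<forall>i\<in>B. v i = b i)"
    if "c \<in> Pi\<^sub>E B (vals T)" "\<And>i. i \<in> B \<Longrightarrow> b i = c i" for v c B
  proof
    assume "\<forall>i\<in>B. v i = b i"
    then show "restrict v B = c" using that by (intro extensionalityI[of _ B]) (auto simp: PiE_def)
  qed (use that in auto)
  note pins = pin[OF assms(13) bY] pin[OF assms(14) bz] pin[OF assms(15) bw]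
  have xz: "merge X Z (x, z) \<in> Pi\<^sub>E (X \<union> Z) (vals T)"
    using assms(7,12,14) by (auto simp: PiE_iff)
  have xzb: "merge X Z (x, z) i = b i" if "i \<in> X \<union> Z" for i
    using assms(7) that bx bz by auto
  have bv: "b i \<in> vals T i" if "i \<in> X \<union> Z" for i
    using PiE_mem[OF xz that] xzb[OF that] by simp
  note rule_prems = assms(2-5) assms(6,7,10,11,9)
  have "\<P>(v in joint (intervene T X x). restrict v Y = y \<bar> restrict v Z = z \<and> restrict v W = w)
      = \<P>(v in joint (intervene T X x). restrict v Y = y \<bar> restrict v W = w)"
    if "d_separated (cut_into X (arrows T)) Y Z (X \<union> W)"
      "\<P>(v in joint (intervene T X x). restrict v Z = z \<and> restrict v W = w) > 0"
      "\<P>(v in joint (intervene T X x). restrict v W = w) > 0"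
    by (rule cond_prob_intervene[OF assms(12) bx assms(12) bx _ _ _ that(2,3)
          pin_prob_rule1[OF rule_prems bv that(1)]]) (auto simp: pins)
  moreover have "\<P>(v in joint (intervene T (X \<union> Z) (merge X Z (x, z))). restrict v Y = y \<bar> restrict v W = w)
      = \<P>(v in joint (intervene T X x). restrict v Y = y \<bar> restrict v Z = z \<and> restrict v W = w)"
    if "d_separated (cut_out_of Z (cut_into X (arrows T))) Y Z (X \<union> W)"
      "\<P>(v in joint (intervene T (X \<union> Z) (merge X Z (x, z))). restrict v W = w) > 0"
      "\<P>(v in joint (intervene T X x). restrict v Z = z \<and> restrict v W = w) > 0"
    by (rule cond_prob_intervene[OF xz xzb assms(12) bx _ _ _ that(2,3)
          pin_prob_rule2[OF rule_prems bv that(1)]]) (auto simp: pins)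
  moreover have "\<P>(v in joint (intervene T (X \<union> Z) (merge X Z (x, z))). restrict v Y = y \<bar> restrict v W = w)
      = \<P>(v in joint (intervene T X x). restrict v Y = y \<bar> restrict v W = w)"
    if "d_separated (cut_into (non_ancestors (cut_into X (arrows T)) Z W) (cut_into X (arrows T))) Y Z (X \<union> W)"
      "\<P>(v in joint (intervene T (X \<union> Z) (merge X Z (x, z))). restrict v W = w) > 0"
      "\<P>(v in joint (intervene T X x). restrict v W = w) > 0"
    by (rule cond_prob_intervene[OF xz xzb assms(12) bx _ _ _ that(2,3)
          pin_prob_rule3[OF rule_prems bv that(1)]]) (auto simp: pins)
  ultimately show ?thesis unfolding Let_def by blast
qed

end
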